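(* Let $(X, G)$ be an expansive action of a sofic group with $\kappa> 0$ an expansive constant and let $\mathcal{U}\in \mathcal{C}_X$. Assume that $\mathrm{diam} (\mathcal{U})\le c \kappa$ for some $c< 1$. Then $h (G, X| \mathcal{U})\le 0$.
   Context: Setting: $G$ is a countable discrete sofic group with a fixed sofic approximation $\Sigma=\{\sigma_i: G \rightarrow \mathrm{Sym}(d_i),\ g\mapsto \sigma_{i, g}\}_{i\in \mathbb{N}}$, where $d_i\in\mathbb{N}$, $d_i\to\infty$, $\mathrm{Sym}(d)$ is the permutation group of $\{1,\dots,d\}$, and $\lim_{i} \frac{1}{d_i} |\{a: \sigma_{i,s}\sigma_{i,t}(a)=\sigma_{i,st}(a)\}|=1$ for all $s,t\in G$, $\lim_{i} \frac{1}{d_i} |\{a: \sigma_{i,s}(a)\neq \sigma_{i,t}(a)\}|=1$ for all distinct $s,t\in G$. $G$ acts continuously on a compact metric space $(X,\rho)$. $(X,G)$ is expansive with expansive constant $\kappa>0$ if for any two different points $x_1,x_2\in X$ there is $g\in G$ with $\rho(gx_1,gx_2)>\kappa$. $\mathcal{C}_X$ and $\mathcal{C}_X^o$ are the sets of finite Borel covers and of finite open covers of $X$. $\mathrm{diam}(\mathcal{U})$ is the maximal diameter of the elements of $\mathcal{U}$. For a cover $\mathcal{V}$ and a set $K$, $N(\mathcal{V},K)$ is the minimal cardinality of sub-families of $\mathcal{V}$ covering $K$ ($N(\mathcal{V},\emptyset)=0$). For $\mathcal{U}\in\mathcal{C}_X$, $\mathcal{U}^d$ is the cover of $X^d$ consisting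 of all products $U_1\times\cdots\times U_d$ with $U_j\in\mathcal{U}$. Convention: $\log 0=-\infty$. $\mathfrak{F}_G$ is the set of non-empty finite subsets of $G$. For $F\in\mathfrak{F}_G$, $\delta>0$, $\sigma:G\to\mathrm{Sym}(d)$, put $$X^d_{F,\delta,\sigma}=\left\{(x_1,\dots,x_d)\in X^d:\max_{s\in F}\sqrt{\sum_{j=1}^d\frac1d\rho^2(sx_j,x_{\sigma_s(j)})}<\delta\right\}.$$ For $\mathcal{U}_1,\mathcal{U}_2\in\mathcal{C}_X$ define $$h_{F,\delta}(G,\mathcal{U}_1|\mathcal{U}_2)=\limsup_{i\to\infty}\frac1{d_i}\log\max_{V\in\mathcal{U}_2^{d_i}}N\left(\mathcal{U}_1^{d_i},X^{d_i}_{F,\delta,\sigma_i}\cap V\right),$$ $h(G,\mathcal{U}_1|\mathcal{U}_2)=\inf_{F\in\mathfrak{F}_G}\inf_{\delta>0}h_{F,\delta}(G,\mathcal{U}_1|\mathcal{U}_2)$, and $h(G,X|\mathcal{U}_2)=\sup_{\mathcal{U}_1\in\mathcal{C}_X^o}h(G,\mathcal{U}_1|\mathcal{U}_2)$. *)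

theory Defs
  imports "HOL-Analysis.Analysis" "HOL-Combinatorics.Permutations" "HOL-Algebra.Group_Action"
begin

text \<open>\<open>\<sigma> i g\<close> is the permutation $\sigma_{i,g}$ of \<open>{1..d i}\<close>; soficity of the group is witnessed by
  the existence of \<open>d\<close> and \<open>\<sigma>\<close>.\<close>

definition sofic_approximation ::
    "('g, 'r) monoid_scheme \<Rightarrow> (nat \<Rightarrow> nat) \<Rightarrow> (nat \<Rightarrow> 'g \<Rightarrow> nat \<Rightarrow> nat) \<Rightarrow> bool" where
  "sofic_approximation G d \<sigma> \<longleftrightarrow>
     filterlim d at_top sequentially \<and>
     (\<forall>i. \<forall>g\<in>carrier G. \<sigma> i g permutes {1..d i}) \<and>
     (\<forall>s\<in>carrier G. \<forall>t\<in>carrier G.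
        (\<lambda>i. 1 / real (d i) * real (card {a \<in> {1..d i}. \<sigma> i s (\<sigma> i t a) = \<sigma> i (s \<otimes>\<^bsub>G\<^esub> t) a}))
          \<longlonglongrightarrow> 1) \<and>
     (\<forall>s\<in>carrier G. \<forall>t\<in>carrier G. s \<noteq> t \<longrightarrow>
        (\<lambda>i. 1 / real (d i) * real (card {a \<in> {1..d i}. \<sigma> i s a \<noteq> \<sigma> i t a})) \<longlonglongrightarrow> 1)"

text \<open>Since the acting group is discrete, continuity of the action means continuity of each
  of the maps \<open>act g\<close>.\<close>

definition continuous_action ::
    "('g, 'r) monoid_scheme \<Rightarrow> 'x::metric_space set \<Rightarrow> ('g \<Rightarrow> 'x \<Rightarrow> 'x) \<Rightarrow> bool" where
  "continuous_action G X act \<longleftrightarrow>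
     group_action G X act \<and> (\<forall>g\<in>carrier G. continuous_on X (act g))"

definition expansive_constant ::
    "('g, 'r) monoid_scheme \<Rightarrow> 'x::metric_space set \<Rightarrow> ('g \<Rightarrow> 'x \<Rightarrow> 'x) \<Rightarrow> real \<Rightarrow> bool" where
  "expansive_constant G X act \<kappa> \<longleftrightarrow>
     \<kappa> > 0 \<and>
     (\<forall>x\<^sub>1\<in>X. \<forall>x\<^sub>2\<in>X. x\<^sub>1 \<noteq> x\<^sub>2 \<longrightarrow> (\<exists>g\<in>carrier G. dist (act g x\<^sub>1) (act g x\<^sub>2) > \<kappa>))"

definition borel_covers :: "'x::metric_space set \<Rightarrow> 'x set set set" where
  "borel_covers X = {\<U>. finite \<U> \<and> (\<forall>U\<in>\<U>. U \<in> sets (restrict_space borel X)) \<and> \<Union>\<U> = X}"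

definition open_covers :: "'x::metric_space set \<Rightarrow> 'x set set set" where
  "open_covers X = {\<U>. finite \<U> \<and> (\<forall>U\<in>\<U>. openin (top_of_set X) U) \<and> \<Union>\<U> = X}"

definition cover_diam :: "'x::metric_space set set \<Rightarrow> real" where
  "cover_diam \<U> = Max (diameter ` \<U>)"

definition cover_number :: "'y set set \<Rightarrow> 'y set \<Rightarrow> nat" where
  "cover_number \<V> K = Inf {card \<W> | \<W>. finite \<W> \<and> \<W> \<subseteq> \<V> \<and> K \<subseteq> \<Union>\<W>}"

text \<open>Points of $X^d$ are extensional functions on \<open>{1..d}\<close>.\<close>

definition power_cover :: "'x set set \<Rightarrow> nat \<Rightarrow> (nat \<Rightarrow> 'x) set set" where
  "power_cover \<U> d = {Pi\<^sub>E {1..d} U | U. \<forall>j\<in>{1..d}. U j \<in> \<U>}"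

definition log_card :: "nat \<Rightarrow> ereal" where
  "log_card n = (if n = 0 then -\<infinity> else ereal (ln (real n)))"

definition approx_orbits ::
    "'x::metric_space set \<Rightarrow> ('g \<Rightarrow> 'x \<Rightarrow> 'x) \<Rightarrow> 'g set \<Rightarrow> real \<Rightarrow> nat \<Rightarrow> ('g \<Rightarrow> nat \<Rightarrow> nat)
      \<Rightarrow> (nat \<Rightarrow> 'x) set" where
  "approx_orbits X act F \<delta> d \<tau> =
     {x \<in> {1..d} \<rightarrow>\<^sub>E X.
        Max ((\<lambda>s. sqrt (\<Sum>j=1..d. 1 / real d * (dist (act s (x j)) (x (\<tau> s j)))\<^sup>2)) ` F) < \<delta>}"

text \<open>The supremum over \<open>V\<close> is taken in \<open>nat\<close>: for a finite nonempty index family it is the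
  maximum, and it is \<open>0\<close> for the empty family, which can occur only when \<open>X\<close> is empty.\<close>

definition cond_entropy_local ::
    "'x::metric_space set \<Rightarrow> ('g \<Rightarrow> 'x \<Rightarrow> 'x) \<Rightarrow> (nat \<Rightarrow> nat) \<Rightarrow> (nat \<Rightarrow> 'g \<Rightarrow> nat \<Rightarrow> nat)
      \<Rightarrow> 'g set \<Rightarrow> real \<Rightarrow> 'x set set \<Rightarrow> 'x set set \<Rightarrow> ereal" where
  "cond_entropy_local X act d \<sigma> F \<delta> \<U>\<^sub>1 \<U>\<^sub>2 =
     limsup (\<lambda>i. ereal (1 / real (d i)) *
       log_card (SUP V\<in>power_cover \<U>\<^sub>2 (d i).
         cover_number (power_cover \<U>\<^sub>1 (d i)) (approx_orbits X act F \<delta> (d i) (\<sigma> i) \<inter> V)))"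

definition cond_entropy_cover ::
    "('g, 'r) monoid_scheme \<Rightarrow> 'x::metric_space set \<Rightarrow> ('g \<Rightarrow> 'x \<Rightarrow> 'x) \<Rightarrow> (nat \<Rightarrow> nat)
      \<Rightarrow> (nat \<Rightarrow> 'g \<Rightarrow> nat \<Rightarrow> nat) \<Rightarrow> 'x set set \<Rightarrow> 'x set set \<Rightarrow> ereal" where
  "cond_entropy_cover G X act d \<sigma> \<U>\<^sub>1 \<U>\<^sub>2 =
     (INF F\<in>{F. F \<subseteq> carrier G \<and> finite F \<and> F \<noteq> {}}. INF \<delta>\<in>{0<..}.
        cond_entropy_local X act d \<sigma> F \<delta> \<U>\<^sub>1 \<U>\<^sub>2)"

definition cond_entropy ::
    "('g, 'r) monoid_scheme \<Rightarrow> 'x::metric_space set \<Rightarrow> ('g \<Rightarrow> 'x \<Rightarrow> 'x) \<Rightarrow> (nat \<Rightarrow> nat)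
      \<Rightarrow> (nat \<Rightarrow> 'g \<Rightarrow> nat \<Rightarrow> nat) \<Rightarrow> 'x set set \<Rightarrow> ereal" where
  "cond_entropy G X act d \<sigma> \<U>\<^sub>2 =
     (SUP \<U>\<^sub>1\<in>open_covers X. cond_entropy_cover G X act d \<sigma> \<U>\<^sub>1 \<U>\<^sub>2)"

end

theory Submission
  imports Defs
begin

text \<open>Two approximate orbits \<open>x\<close>, \<open>y\<close> in the same \<open>V \<in> \<U>\<^bsup>d\<^esup>\<close> satisfy
  \<open>dist (s x\<^sub>j) (s y\<^sub>j) \<le> c \<kappa> + dist (s x\<^sub>j) (x\<^bsub>\<sigma>\<^sub>s j\<^esub>) + dist (s y\<^sub>j) (y\<^bsub>\<sigma>\<^sub>s j\<^esub>)\<close>, which by Chebyshev's inequality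
  is at most \<open>\<kappa>\<close> for all \<open>s \<in> F\<close> except at a small proportion of the coordinates \<open>j\<close>.
  By compactness, expansiveness is witnessed up to any scale \<open>\<epsilon>\<close> by a finite set \<open>F\<close>, so
  \<open>x\<^sub>j\<close> and \<open>y\<^sub>j\<close> are \<open>\<epsilon>\<close>-close at all other \<open>j\<close>. With \<open>\<epsilon>\<close> a Lebesgue number of \<open>\<U>\<^sub>1\<close>,
  the approximate orbits in \<open>V\<close> are thus covered by the members of \<open>\<U>\<^sub>1\<^bsup>d\<^esup>\<close> that lie in a Hamming
  ball of small relative radius, and the exponential growth rate of their number is small.\<close>

section \<open>Compactness: finite expansiveness witnesses and Lebesgue numbers\<close>

text \<open>Among the pairs at distance at least \<open>\<epsilon>\<close>, a compact set
  \<open>K\<close>, those that \<open>g\<close> does not separate beyond \<open>\<kappa>\<close>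
  form a closed set \<open>C g\<close>. Expansiveness makes the total intersection empty, so by the
  finite intersection property finitely many \<open>g\<close> suffice.\<close>

lemma finite_expansive_witness:
  assumes "compact X" and "continuous_action G X act" and "expansive_constant G X act \<kappa>"
    and "\<epsilon> > 0"
  obtains F where "F \<subseteq> carrier G" "finite F"
    "\<And>x y. \<lbrakk>x \<in> X; y \<in> X; \<forall>g\<in>F. dist (act g x) (act g y) \<le> \<kappa>\<rbrakk> \<Longrightarrow> dist x y < \<epsilon>"
proof -
  define K where "K = (X \<times> X) \<inter> {p. \<epsilon> \<le> dist (fst p) (snd p)}"
  define C where "C g = K \<inter> {p. dist (act g (fst p)) (act g (snd p)) \<le> \<kappa>}" for g
  have K: "compact K"
    unfolding K_def using assms(1)
    by (intro compact_Int_closed compact_Times closed_Collect_le continuous_intros)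
  have C: "closed (C g)" if "g \<in> carrier G" for g
  proof -
    have g: "continuous_on X (act g)"
      using assms(2) that by (simp add: continuous_action_def)
    have "continuous_on K (\<lambda>p. dist (act g (fst p)) (act g (snd p)))"
      by (intro continuous_intros continuous_on_compose2[OF g]) (auto simp: K_def)
    then have "closedin (top_of_set K) (K \<inter> (\<lambda>p. dist (act g (fst p)) (act g (snd p))) -` {..\<kappa>})"
      by (rule continuous_closedin_preimage) simp
    then show ?thesis
      using compact_imp_closed[OF K] closedin_closed_trans
      by (fastforce simp: C_def vimage_def)
  qed
  have "K \<inter> \<Inter> (C ` carrier G) = {}"
  proof (rule ccontr)
    assume "K \<inter> \<Inter> (C ` carrier G) \<noteq> {}"
    then obtain x y where xy: "(x, y) \<in> K" "\<forall>g\<in>carrier G. (x, y) \<in> C g" by auto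
    then have "x \<in> X" "y \<in> X" "x \<noteq> y" using \<open>\<epsilon> > 0\<close> by (auto simp: K_def)
    with assms(3) obtain g where "g \<in> carrier G" "dist (act g x) (act g y) > \<kappa>"
      unfolding expansive_constant_def by blast
    with xy(2) show False by (fastforce simp: C_def)
  qed
  moreover have "K \<inter> \<Inter> (C ` carrier G) \<noteq> {}"
    if "\<And>F. \<lbrakk>finite F; F \<subseteq> carrier G\<rbrakk> \<Longrightarrow> K \<inter> \<Inter> (C ` F) \<noteq> {}"
    using K C that by (rule compact_imp_fip_image)
  ultimately obtain F where F: "finite F" "F \<subseteq> carrier G" "K \<inter> \<Inter> (C ` F) = {}"
    by blast
  show thesis
  proof
    fix x y assume xy: "x \<in> X" "y \<in> X" "\<forall>g\<in>F. dist (act g x) (act g y) \<le> \<kappa>"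
    show "dist x y < \<epsilon>"
    proof (rule ccontr)
      assume "\<not> dist x y < \<epsilon>"
      with xy have "(x, y) \<in> K \<inter> \<Inter> (C ` F)" by (auto simp: K_def C_def)
      with F(3) show False by blast
    qed
  qed (use F in auto)
qed

lemma open_cover_Lebesgue_number:
  assumes "compact X" and "\<U> \<in> open_covers X"
  obtains \<epsilon> where "\<epsilon> > 0" "\<And>x. x \<in> X \<Longrightarrow> \<exists>U\<in>\<U>. X \<inter> ball x \<epsilon> \<subseteq> U"
proof -
  define \<G> where "\<G> = {T. open T \<and> X \<inter> T \<in> \<U>}"
  have "X \<subseteq> \<Union>\<G>"
  proof
    fix x assume "x \<in> X"
    with assms(2) obtain U where U: "U \<in> \<U>" "x \<in> U" "openin (top_of_set X) U"
      unfolding open_covers_def by blast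
    then obtain T where "open T" "U = X \<inter> T" by (auto simp: openin_open)
    with U show "x \<in> \<Union>\<G>" by (auto simp: \<G>_def)
  qed
  then obtain \<epsilon> where "\<epsilon> > 0" and e: "\<And>x. x \<in> X \<Longrightarrow> \<exists>T\<in>\<G>. ball x \<epsilon> \<subseteq> T"
    using Heine_Borel_lemma[OF assms(1)] by (metis (no_types, lifting) \<G>_def mem_Collect_eq)
  show thesis
  proof (rule that[OF \<open>\<epsilon> > 0\<close>])
    fix x assume "x \<in> X"
    with e obtain T where "X \<inter> T \<in> \<U>" "ball x \<epsilon> \<subseteq> T" by (auto simp: \<G>_def)
    then show "\<exists>U\<in>\<U>. X \<inter> ball x \<epsilon> \<subseteq> U" by blast
  qed
qed

section \<open>Counting words in Hamming balls\<close>

text \<open>Weight each word by \<open>t\<close> to the power of its Hamming distance from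
  \<open>a\<close>. Since \<open>t \<le> 1\<close>, words of the ball weigh at least
  \<open>t powr k\<close>, while the total weight of all words factors over the coordinates. The
  parameter \<open>t\<close> stays free so that it can be tuned later.\<close>

lemma card_Hamming_ball_le:
  fixes t k :: real
  assumes "finite J" and "finite A" and "0 < t" "t \<le> 1"
  shows "real (card {w \<in> J \<rightarrow>\<^sub>E A. real (card {j \<in> J. w j \<noteq> a j}) \<le> k})
           \<le> (1 + real (card A) * t) ^ card J * (1 / t) powr k"
proof -
  let ?H = "{w \<in> J \<rightarrow>\<^sub>E A. real (card {j \<in> J. w j \<noteq> a j}) \<le> k}"
  let ?f = "\<lambda>w. \<Prod>j\<in>J. if w j = a j then 1 else t"
  have fin: "finite (J \<rightarrow>\<^sub>E A)" using assms by (simp add: finite_PiE)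
  have f: "?f w = t ^ card {j \<in> J. w j \<noteq> a j}" for w
  proof -
    have "?f w = (\<Prod>j\<in>{j \<in> J. w j \<noteq> a j}. t)"
      using assms(1) by (intro prod.mono_neutral_cong_right) auto
    then show ?thesis by simp
  qed
  have "real (card ?H) * t powr k = (\<Sum>w\<in>?H. t powr k)" by simp
  also have "\<dots> \<le> (\<Sum>w\<in>?H. ?f w)"
  proof (rule sum_mono)
    fix w assume "w \<in> ?H"
    then have "t powr k \<le> t powr real (card {j \<in> J. w j \<noteq> a j})"
      using assms by (intro powr_mono') auto
    then show "t powr k \<le> ?f w" using \<open>0 < t\<close> by (simp only: f powr_realpow)
  qed
  also have "\<dots> \<le> (\<Sum>w\<in>J \<rightarrow>\<^sub>E A. ?f w)"
    using fin assms by (intro sum_mono2 prod_nonneg) auto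
  also have "\<dots> = (\<Prod>j\<in>J. \<Sum>u\<in>A. if u = a j then 1 else t)"
    using assms by (subst prod_sum_PiE) auto
  also have "\<dots> \<le> (\<Prod>j\<in>J. 1 + real (card A) * t)"
  proof (rule prod_mono, intro conjI)
    fix j
    \<comment> \<open>The letter \<open>a j\<close> may lie outside \<open>A\<close>, so the
      indicator contributes at most 1.\<close>
    have "(\<Sum>u\<in>A. if u = a j then 1 else t) \<le> (\<Sum>u\<in>A. (if u = a j then 1 else 0) + t)"
      using assms by (intro sum_mono) auto
    also have "\<dots> \<le> 1 + real (card A) * t"
      using assms by (simp add: sum.distrib)
    finally show "(\<Sum>u\<in>A. if u = a j then 1 else t) \<le> 1 + real (card A) * t" .
  qed (use assms in \<open>auto intro!: sum_nonneg\<close>)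
  finally have "real (card ?H) * t powr k \<le> (1 + real (card A) * t) ^ card J" by simp
  then show ?thesis
    using assms by (simp add: powr_divide field_simps)
qed

lemma cover_number_le:
  assumes "finite \<W>" "\<W> \<subseteq> \<V>" "K \<subseteq> \<Union>\<W>"
  shows "cover_number \<V> K \<le> card \<W>"
  unfolding cover_number_def using assms by (intro cInf_lower) auto

section \<open>Coordinates where two approximate orbits separate\<close>

text \<open>Chebyshev's inequality: the mean square of the displacements is below
  \<open>\<delta>\<^sup>2\<close>.\<close>

lemma card_large_deviations_le:
  assumes "x \<in> approx_orbits X act F \<delta> d \<tau>" and "finite F" "s \<in> F" and "d > 0" "\<eta> > 0"
  shows "real (card {j \<in> {1..d}. \<eta> \<le> dist (act s (x j)) (x (\<tau> s j))}) \<le> real d * \<delta>\<^sup>2 / \<eta>\<^sup>2"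
proof -
  let ?r = "\<lambda>j. dist (act s (x j)) (x (\<tau> s j))"
  let ?B = "{j \<in> {1..d}. \<eta> \<le> ?r j}"
  let ?S = "\<Sum>j=1..d. 1 / real d * (?r j)\<^sup>2"
  have "sqrt ?S \<le> Max ((\<lambda>s. sqrt (\<Sum>j=1..d. 1 / real d * (dist (act s (x j)) (x (\<tau> s j)))\<^sup>2)) ` F)"
    using \<open>finite F\<close> \<open>s \<in> F\<close> by (intro Max_ge) auto
  also have "\<dots> < \<delta>"
    using assms(1) by (simp add: approx_orbits_def)
  finally have "sqrt ?S < \<delta>" .
  then have "?S \<le> \<delta>\<^sup>2" by (intro sqrt_le_D) simp
  moreover have "(\<Sum>j\<in>?B. 1 / real d * \<eta>\<^sup>2) \<le> (\<Sum>j\<in>?B. 1 / real d * (?r j)\<^sup>2)"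
    using assms by (intro sum_mono mult_left_mono power_mono) auto
  moreover have "\<dots> \<le> ?S"
    by (intro sum_mono2) auto
  ultimately have "real (card ?B) * (1 / real d * \<eta>\<^sup>2) \<le> \<delta>\<^sup>2" by simp
  then show ?thesis using assms by (simp add: field_simps)
qed

text \<open>If \<open>j\<close> avoids every exceptional set, the slack \<open>2 * \<eta>\<close> in
  \<open>close\<close>, used at the coordinate \<open>\<tau> s j\<close>, absorbs the displacements
  of both orbits, and \<open>wit\<close> applies. A union bound over \<open>s\<close> and the two
  orbits gives the factor \<open>2 * card F\<close>.\<close>

lemma card_separated_coordinates_le:
  assumes x: "x \<in> approx_orbits X act F \<delta> d \<tau>" and y: "y \<in> approx_orbits X act F \<delta> d \<tau>"
    and F: "finite F" and \<tau>: "\<And>s. s \<in> F \<Longrightarrow> \<tau> s permutes {1..d}" and "d > 0" "\<eta> > 0"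
    and close: "\<And>j. j \<in> {1..d} \<Longrightarrow> dist (x j) (y j) \<le> \<kappa> - 2 * \<eta>"
    and wit: "\<And>x y. \<lbrakk>x \<in> X; y \<in> X; \<forall>g\<in>F. dist (act g x) (act g y) \<le> \<kappa>\<rbrakk> \<Longrightarrow> dist x y < \<epsilon>"
  shows "real (card {j \<in> {1..d}. \<epsilon> \<le> dist (x j) (y j)}) \<le> 2 * real (card F) * (real d * \<delta>\<^sup>2 / \<eta>\<^sup>2)"
proof -
  define B where "B z s = {j \<in> {1..d}. \<eta> \<le> dist (act s (z j)) (z (\<tau> s j))}" for z s
  have fin: "finite (B z s)" for z s by (simp add: B_def)
  have "{j \<in> {1..d}. \<epsilon> \<le> dist (x j) (y j)} \<subseteq> (\<Union>s\<in>F. B x s \<union> B y s)"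
  proof (rule ccontr)
    assume "\<not> ?thesis"
    then obtain j where j: "j \<in> {1..d}" "\<epsilon> \<le> dist (x j) (y j)"
      and nb: "\<And>s. s \<in> F \<Longrightarrow> j \<notin> B x s \<and> j \<notin> B y s" by blast
    have "dist (act s (x j)) (act s (y j)) \<le> \<kappa>" if s: "s \<in> F" for s
    proof -
      have "\<tau> s j \<in> {1..d}" using permutes_in_image[OF \<tau>[OF s]] j(1) by blast
      then have "dist (x (\<tau> s j)) (y (\<tau> s j)) \<le> \<kappa> - 2 * \<eta>" by (rule close)
      moreover have "dist (act s (x j)) (x (\<tau> s j)) < \<eta>" "dist (act s (y j)) (y (\<tau> s j)) < \<eta>"
        using nb[OF s] j(1) by (auto simp: B_def)
      ultimately show ?thesis by metric
    qed
    moreover have "x j \<in> X" "y j \<in> X"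
      using x y j(1) by (auto simp: approx_orbits_def PiE_iff)
    ultimately show False using wit[of "x j" "y j"] j(2) by fastforce
  qed
  then have "card {j \<in> {1..d}. \<epsilon> \<le> dist (x j) (y j)} \<le> card (\<Union>s\<in>F. B x s \<union> B y s)"
    using F fin by (intro card_mono) auto
  also have "\<dots> \<le> (\<Sum>s\<in>F. card (B x s \<union> B y s))" by (rule card_UN_le[OF F])
  also have "\<dots> \<le> (\<Sum>s\<in>F. card (B x s) + card (B y s))" by (intro sum_mono card_Un_le)
  finally have "real (card {j \<in> {1..d}. \<epsilon> \<le> dist (x j) (y j)})
      \<le> (\<Sum>s\<in>F. real (card (B x s)) + real (card (B y s)))"
    by (simp flip: of_nat_add of_nat_sum)
  also have "\<dots> \<le> (\<Sum>s\<in>F. 2 * (real d * \<delta>\<^sup>2 / \<eta>\<^sup>2))"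
  proof (rule sum_mono)
    fix s assume s: "s \<in> F"
    show "real (card (B x s)) + real (card (B y s)) \<le> 2 * (real d * \<delta>\<^sup>2 / \<eta>\<^sup>2)"
      unfolding B_def mult_2
      using x y F s \<open>d > 0\<close> \<open>\<eta> > 0\<close> by (intro add_mono card_large_deviations_le)
  qed
  finally show ?thesis by (simp add: mult.assoc mult.left_commute)
qed

section \<open>Covering by Hamming neighbours of one code word\<close>

text \<open>Fix one \<open>x\<close> in \<open>K\<close> and code it by sets \<open>a j\<close>
  containing the \<open>\<epsilon>\<close>-balls around \<open>x j\<close>. Any other point of
  \<open>K\<close> can reuse \<open>a j\<close> wherever it is \<open>\<epsilon>\<close>-close to
  \<open>x\<close>, so its code lies in a Hamming ball around \<open>a\<close>.\<close>

lemma cover_number_Hamming_neighbours_le: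
  fixes t k :: real
  assumes \<U>: "finite \<U>" and leb: "\<And>x. x \<in> X \<Longrightarrow> \<exists>U\<in>\<U>. X \<inter> ball x \<epsilon> \<subseteq> U" "\<Union>\<U> = X"
    and K: "K \<subseteq> {1..d} \<rightarrow>\<^sub>E X"
    and near: "\<And>x y. \<lbrakk>x \<in> K; y \<in> K\<rbrakk> \<Longrightarrow> real (card {j \<in> {1..d}. \<epsilon> \<le> dist (x j) (y j)}) \<le> k"
    and t: "0 < t" "t \<le> 1"
  shows "real (cover_number (power_cover \<U> d) K) \<le> (1 + real (card \<U>) * t) ^ d * (1 / t) powr k"
proof (cases "K = {}")
  case True
  then have "cover_number (power_cover \<U> d) K \<le> card ({} :: (nat \<Rightarrow> 'a) set set)"
    by (intro cover_number_le) auto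
  moreover have "0 \<le> (1 + real (card \<U>) * t) ^ d * (1 / t) powr k" using t by simp
  ultimately show ?thesis by simp
next
  case False
  then obtain x where x: "x \<in> K" by blast
  have "\<forall>j\<in>{1..d}. \<exists>U\<in>\<U>. X \<inter> ball (x j) \<epsilon> \<subseteq> U"
    using x K leb(1) by (auto simp: PiE_iff)
  then obtain a where a: "\<And>j. j \<in> {1..d} \<Longrightarrow> a j \<in> \<U> \<and> X \<inter> ball (x j) \<epsilon> \<subseteq> a j" by metis
  let ?H = "{w \<in> {1..d} \<rightarrow>\<^sub>E \<U>. real (card {j \<in> {1..d}. w j \<noteq> a j}) \<le> k}"
  have fin: "finite ?H" using \<U> by (simp add: finite_PiE)
  have "cover_number (power_cover \<U> d) K \<le> card (Pi\<^sub>E {1..d} ` ?H)"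
  proof (rule cover_number_le)
    show "finite (Pi\<^sub>E {1..d} ` ?H)" using fin by simp
    show "Pi\<^sub>E {1..d} ` ?H \<subseteq> power_cover \<U> d"
      by (auto simp: power_cover_def)
    show "K \<subseteq> \<Union> (Pi\<^sub>E {1..d} ` ?H)"
    proof
      fix y assume y: "y \<in> K"
      then have yX: "y j \<in> X" if "j \<in> {1..d}" for j using K that by (auto simp: PiE_iff)
      then have "\<forall>j\<in>{1..d}. \<exists>U\<in>\<U>. y j \<in> U" using leb(2) by blast
      then obtain u where u: "\<And>j. j \<in> {1..d} \<Longrightarrow> u j \<in> \<U> \<and> y j \<in> u j" by metis
      define w where "w = (\<lambda>j\<in>{1..d}. if dist (x j) (y j) < \<epsilon> then a j else u j)"
      have "w \<in> {1..d} \<rightarrow>\<^sub>E \<U>" using a u by (auto simp: w_def)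
      moreover have "y \<in> Pi\<^sub>E {1..d} w"
      proof (rule PiE_I)
        fix j assume j: "j \<in> {1..d}"
        then show "y j \<in> w j"
          using a[OF j] u[OF j] yX[OF j] by (auto simp: w_def)
      next
        fix j assume "j \<notin> {1..d}"
        then show "y j = undefined" using y K by (metis PiE_arb subsetD)
      qed
      moreover have "card {j \<in> {1..d}. w j \<noteq> a j} \<le> card {j \<in> {1..d}. \<epsilon> \<le> dist (x j) (y j)}"
        by (intro card_mono) (auto simp: w_def)
      with near[OF x y] have "real (card {j \<in> {1..d}. w j \<noteq> a j}) \<le> k" by linarith
      ultimately show "y \<in> \<Union> (Pi\<^sub>E {1..d} ` ?H)" by blast
    qed
  qed
  \<comment> \<open>Distinct words may give the same product, for instance when a factor is
    empty.\<close>
  also have "\<dots> \<le> card ?H" using fin by (rule card_image_le)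
  finally have "real (cover_number (power_cover \<U> d) K) \<le> real (card ?H)" by simp
  also have "\<dots> \<le> (1 + real (card \<U>) * t) ^ d * (1 / t) powr k"
    using card_Hamming_ball_le[OF _ \<U> t, of "{1..d}" a k] by simp
  finally show ?thesis .
qed

section \<open>Suprema, diameters and passage to the limsup\<close>

lemma Sup_nat_le:
  fixes A :: "nat set"
  assumes "\<And>a. a \<in> A \<Longrightarrow> real a \<le> r" "0 \<le> r"
  shows "real (Sup A) \<le> r"
proof (cases "A = {}")
  case False
  have "Sup A \<le> nat \<lfloor>r\<rfloor>" using False assms by (intro cSup_least) (auto simp: le_nat_floor)
  then show ?thesis using assms(2) by linarith
\<comment> \<open>The supremum of the empty set in \<open>nat\<close> is 0, which is where
  \<open>0 \<le> r\<close> enters.\<close>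
qed (use assms in \<open>simp add: Sup_nat_def\<close>)

lemma log_card_le:
  assumes "real n \<le> r"
  shows "log_card n \<le> ereal (ln r)"
  using assms by (auto simp: log_card_def)

lemma dist_le_cover_diam:
  assumes "\<U> \<in> borel_covers X" "compact X" "U \<in> \<U>" "x \<in> U" "y \<in> U"
  shows "dist x y \<le> cover_diam \<U>"
proof -
  have "U \<subseteq> X" "finite \<U>" using assms by (auto simp: borel_covers_def)
  \<comment> \<open>\<open>diameter\<close> controls distances only in bounded sets.\<close>
  then have "bounded U" using assms(2) bounded_subset compact_imp_bounded by blast
  then have "dist x y \<le> diameter U" using assms by (intro diameter_bounded_bound) auto
  also have "\<dots> \<le> cover_diam \<U>"
    unfolding cover_diam_def using \<open>finite \<U>\<close> assms(3) by simp
  finally show ?thesis .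
qed

lemma cond_entropy_local_le:
  assumes d: "filterlim d at_top sequentially"
    and bound: "\<And>i V. \<lbrakk>d i > 0; V \<in> power_cover \<U>\<^sub>2 (d i)\<rbrakk> \<Longrightarrow>
        real (cover_number (power_cover \<U>\<^sub>1 (d i)) (approx_orbits X act F \<delta> (d i) (\<sigma> i) \<inter> V))
          \<le> exp (real (d i) * e)"
  shows "cond_entropy_local X act d \<sigma> F \<delta> \<U>\<^sub>1 \<U>\<^sub>2 \<le> ereal e"
  unfolding cond_entropy_local_def
proof (rule Limsup_bounded)
  \<comment> \<open>Finitely many indices do not affect the limsup, so \<open>d i = 0\<close> can be
    ignored.\<close>
  have "\<forall>\<^sub>F i in sequentially. d i > 0"
    using d eventually_gt_at_top filterlim_iff by blast
  then show "\<forall>\<^sub>F i in sequentially. ereal (1 / real (d i)) * log_card (SUP V\<in>power_cover \<U>\<^sub>2 (d i).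
         cover_number (power_cover \<U>\<^sub>1 (d i)) (approx_orbits X act F \<delta> (d i) (\<sigma> i) \<inter> V)) \<le> ereal e"
  proof eventually_elim
    case (elim i)
    let ?N = "SUP V\<in>power_cover \<U>\<^sub>2 (d i).
         cover_number (power_cover \<U>\<^sub>1 (d i)) (approx_orbits X act F \<delta> (d i) (\<sigma> i) \<inter> V)"
    have "real ?N \<le> exp (real (d i) * e)"
      using bound elim by (intro Sup_nat_le) auto
    then have "log_card ?N \<le> ereal (real (d i) * e)"
      using log_card_le by fastforce
    then have "ereal (1 / real (d i)) * log_card ?N \<le> ereal (1 / real (d i)) * ereal (real (d i) * e)"
      by (intro ereal_mult_left_mono) auto
    then show ?case using elim by simp
  qed
qed

section \<open>Choice of parameters and the final estimate\<close>

theorem theorem3p1: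
  fixes G :: "('g, 'r) monoid_scheme"
    and X :: "'x::metric_space set"
    and act :: "'g \<Rightarrow> 'x \<Rightarrow> 'x"
    and d :: "nat \<Rightarrow> nat"
    and \<sigma> :: "nat \<Rightarrow> 'g \<Rightarrow> nat \<Rightarrow> nat"
    and \<kappa> c :: real
    and \<U> :: "'x set set"
  assumes "group G" and "countable (carrier G)"
    and "sofic_approximation G d \<sigma>"
    and "compact X"
    and "continuous_action G X act"
    and "expansive_constant G X act \<kappa>"
    and "\<U> \<in> borel_covers X"
    and "c < 1" and "cover_diam \<U> \<le> c * \<kappa>"
  shows "cond_entropy G X act d \<sigma> \<U> \<le> 0"
  unfolding cond_entropy_def
proof (rule SUP_least, rule ereal_le_epsilon2)
  fix \<U>\<^sub>1 and e :: real
  assume \<U>\<^sub>1: "\<U>\<^sub>1 \<in> open_covers X" and "0 < e"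
  have fin: "finite \<U>\<^sub>1" "\<Union>\<U>\<^sub>1 = X" using \<U>\<^sub>1 by (auto simp: open_covers_def)
  define m where "m = real (card \<U>\<^sub>1)"
  obtain \<epsilon> where "\<epsilon> > 0" and leb: "\<And>x. x \<in> X \<Longrightarrow> \<exists>U\<in>\<U>\<^sub>1. X \<inter> ball x \<epsilon> \<subseteq> U"
    using open_cover_Lebesgue_number[OF \<open>compact X\<close> \<U>\<^sub>1] by blast
  obtain F0 where F0: "F0 \<subseteq> carrier G" "finite F0"
    and wit0: "\<And>x y. \<lbrakk>x \<in> X; y \<in> X; \<forall>g\<in>F0. dist (act g x) (act g y) \<le> \<kappa>\<rbrakk> \<Longrightarrow> dist x y < \<epsilon>"
    using finite_expansive_witness[OF assms(4-6) \<open>\<epsilon> > 0\<close>] by metis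
  \<comment> \<open>The witness set may be empty, but the infimum runs over non-empty sets; adding
    the identity keeps the witness property.\<close>
  define F where "F = insert \<one>\<^bsub>G\<^esub> F0"
  have F: "F \<subseteq> carrier G" "finite F" "F \<noteq> {}" "0 < card F"
    using F0 group.is_monoid[OF \<open>group G\<close>] monoid.one_closed
    by (auto simp: F_def card_gt_0_iff)
  have wit: "dist x y < \<epsilon>" if "x \<in> X" "y \<in> X" "\<forall>g\<in>F. dist (act g x) (act g y) \<le> \<kappa>" for x y
    using wit0 that by (auto simp: F_def)
  have "\<kappa> > 0" using assms(6) by (simp add: expansive_constant_def)
  \<comment> \<open>Half the gap between \<open>\<kappa>\<close> and the diameter bound
    \<open>c * \<kappa>\<close>.\<close>
  define \<eta> where "\<eta> = (1 - c) * \<kappa> / 2"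
  have "\<eta> > 0" using \<open>c < 1\<close> \<open>\<kappa> > 0\<close> by (simp add: \<eta>_def)
  have \<eta>: "c * \<kappa> = \<kappa> - 2 * \<eta>" by (simp add: \<eta>_def field_simps)
  \<comment> \<open>Makes the growth rate \<open>m * t\<close> of the first Hamming factor at most
    \<open>e / 2\<close>. The cap 1/2 keeps \<open>ln (1 / t)\<close> positive, and
    \<open>m + 1\<close> guards against \<open>m = 0\<close>.\<close>
  define t where "t = min (1/2) (e / (2 * (m + 1)))"
  have "m \<ge> 0" by (simp add: m_def)
  then have t: "0 < t" "t < 1" using \<open>0 < e\<close> by (auto simp: t_def)
  have "m * t \<le> m * (e / (2 * (m + 1)))" using \<open>m \<ge> 0\<close> by (intro mult_left_mono) (auto simp: t_def)
  also have "\<dots> \<le> e / 2" using \<open>m \<ge> 0\<close> \<open>0 < e\<close> by (simp add: field_simps)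
  finally have mt: "m * t \<le> e / 2" .
  \<comment> \<open>The allowed proportion of separated coordinates, chosen so that the second
    factor \<open>(1 / t) powr (\<theta> * real (d i))\<close> also has rate
    \<open>e / 2\<close>.\<close>
  define \<theta> where "\<theta> = e / (2 * ln (1 / t))"
  have lnt: "0 < ln (1 / t)" using t by (intro ln_gt_zero) simp
  then have \<theta>: "\<theta> > 0" "\<theta> * ln (1 / t) = e / 2" using \<open>0 < e\<close> by (auto simp: \<theta>_def)
  \<comment> \<open>Solves \<open>2 * card F * \<delta>\<^sup>2 / \<eta>\<^sup>2 = \<theta>\<close>,
    matching the bound on separated coordinates.\<close>
  define \<delta> where "\<delta> = \<eta> * sqrt (\<theta> / (2 * real (card F)))"
  have "\<delta> > 0" using \<open>\<eta> > 0\<close> \<theta> F by (simp add: \<delta>_def)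
  have \<delta>: "2 * real (card F) * (real n * \<delta>\<^sup>2 / \<eta>\<^sup>2) = \<theta> * real n" for n
    using \<open>\<eta> > 0\<close> \<theta> F by (simp add: \<delta>_def power_mult_distrib)
  have "cond_entropy_cover G X act d \<sigma> \<U>\<^sub>1 \<U> \<le> cond_entropy_local X act d \<sigma> F \<delta> \<U>\<^sub>1 \<U>"
    unfolding cond_entropy_cover_def
    using F \<open>\<delta> > 0\<close> by (intro INF_lower2[of F] INF_lower2[of \<delta>]) auto
  also have "\<dots> \<le> ereal e"
  proof (rule cond_entropy_local_le)
    show "filterlim d at_top sequentially" using assms(3) by (simp add: sofic_approximation_def)
    fix i V
    assume "d i > 0" and V: "V \<in> power_cover \<U> (d i)"
    let ?K = "approx_orbits X act F \<delta> (d i) (\<sigma> i) \<inter> V"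
    from V obtain u where u: "V = Pi\<^sub>E {1..d i} u" "\<And>j. j \<in> {1..d i} \<Longrightarrow> u j \<in> \<U>"
      by (auto simp: power_cover_def)
    have near: "real (card {j \<in> {1..d i}. \<epsilon> \<le> dist (x j) (y j)}) \<le> \<theta> * real (d i)"
      if "x \<in> ?K" "y \<in> ?K" for x y
    proof -
      have "dist (x j) (y j) \<le> \<kappa> - 2 * \<eta>" if j: "j \<in> {1..d i}" for j
      proof -
        have "x j \<in> u j" "y j \<in> u j" using \<open>x \<in> ?K\<close> \<open>y \<in> ?K\<close> u(1) j by (auto simp: PiE_iff)
        then have "dist (x j) (y j) \<le> cover_diam \<U>"
          using dist_le_cover_diam assms(4,7) u(2)[OF j] by metis
        then show ?thesis using assms(9) \<eta> by linarith
      qed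
      moreover have "\<sigma> i s permutes {1..d i}" if "s \<in> F" for s
        using that F assms(3) by (auto simp: sofic_approximation_def)
      ultimately show ?thesis
        using card_separated_coordinates_le[of x X act F \<delta> "d i" "\<sigma> i" y \<eta> \<kappa> \<epsilon>]
          that F \<open>d i > 0\<close> \<open>\<eta> > 0\<close> wit \<delta> by auto
    qed
    have "real (cover_number (power_cover \<U>\<^sub>1 (d i)) ?K)
        \<le> (1 + m * t) ^ d i * (1 / t) powr (\<theta> * real (d i))"
      unfolding m_def
    proof (rule cover_number_Hamming_neighbours_le[OF fin(1) leb fin(2) _ near])
      show "?K \<subseteq> {1..d i} \<rightarrow>\<^sub>E X" by (auto simp: approx_orbits_def)
    qed (use t in auto)
    \<comment> \<open>Uses \<open>1 + m * t \<le> exp (m * t)\<close>.\<close>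
    also have "\<dots> \<le> exp (m * t) ^ d i * exp (\<theta> * real (d i) * ln (1 / t))"
      using t \<open>m \<ge> 0\<close> by (intro mult_mono power_mono) (auto simp: powr_def)
    also have "\<dots> = exp (real (d i) * (m * t + \<theta> * ln (1 / t)))"
      by (simp add: exp_of_nat_mult[symmetric] exp_add[symmetric] algebra_simps)
    also have "\<dots> \<le> exp (real (d i) * e)"
      unfolding exp_le_cancel_iff using mt \<theta> by (intro mult_left_mono) auto
    finally show "real (cover_number (power_cover \<U>\<^sub>1 (d i)) ?K) \<le> exp (real (d i) * e)" .
  qed
  finally show "cond_entropy_cover G X act d \<sigma> \<U>\<^sub>1 \<U> \<le> 0 + ereal e" by simp
qed

end
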